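(* Let $\mu$ be a strictly positive Borel probability measure on $\omega^\omega$. Then there exists an $F_\sigma$ set $F\subseteq\omega^\omega$ with $\mu(F)=1$ such that $[T]\not\subseteq F$ for every Miller tree $T\subseteq\omega^{<\omega}$.
   Context: $\omega^\omega$ is the Baire space with its usual topology; strictly positive means that every nonempty open set has positive measure. $\omega^{<\omega}=\bigcup_{n\in\omega}\omega^n$. A tree is a nonempty set $T\subseteq\omega^{<\omega}$ closed under initial segments. Its body is $[T]=\{x\in\omega^\omega:(\forall n)\ x\restriction n\in T\}$. Let $\omega\text{-}\mathrm{split}(T)=\{\sigma\in T:\{a\in\omega:\sigma^\frown a\in T\}\text{ is infinite}\}$. A tree $T$ is a Miller (superperfect) tree if for every $\sigma\in T$ there is $\tau\in\omega\text{-}\mathrm{split}(T)$ with $\sigma\subseteq\tau$. *)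

theory Defs
  imports "HOL-Probability.Probability" "HOL-Library.Sublist"
begin

text \<open>
  Baire space is the type \<^typ>\<open>nat \<Rightarrow> nat\<close> with the library's product topology, \<^typ>\<open>nat\<close> being
  discrete; finite sequences are lists, with \<open>\<sigma> @ [a]\<close> the extension of \<open>\<sigma>\<close> by \<open>a\<close>.
\<close>

definition strictly_positive :: "'a::topological_space measure \<Rightarrow> bool" where
  "strictly_positive M \<longleftrightarrow> (\<forall>U. open U \<and> U \<noteq> {} \<longrightarrow> emeasure M U > 0)"

definition restrict_seq :: "(nat \<Rightarrow> 'a) \<Rightarrow> nat \<Rightarrow> 'a list" where
  "restrict_seq x n = map x [0..<n]"

definition is_tree :: "'a list set \<Rightarrow> bool" where
  "is_tree T \<longleftrightarrow> T \<noteq> {} \<and> (\<forall>\<tau>\<in>T. \<forall>\<sigma>. prefix \<sigma> \<tau> \<longrightarrow> \<sigma> \<in> T)"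

definition body :: "'a list set \<Rightarrow> (nat \<Rightarrow> 'a) set" where
  "body T = {x. \<forall>n. restrict_seq x n \<in> T}"

definition omega_split :: "'a list set \<Rightarrow> 'a list set" where
  "omega_split T = {\<sigma> \<in> T. infinite {a. \<sigma> @ [a] \<in> T}}"

definition miller_tree :: "nat list set \<Rightarrow> bool" where
  "miller_tree T \<longleftrightarrow> is_tree T \<and> (\<forall>\<sigma>\<in>T. \<exists>\<tau>\<in>omega_split T. prefix \<sigma> \<tau>)"

end

theory Submission
  imports Defs
begin

text \<open>
  The set \<open>F\<close> consists of the sequences that a fixed function \<open>g\<close> bounds at all but
  finitely many coordinates. Since every sequence has a finite \<open>k\<close>-th coordinate, the measure
  of \<open>{x. m < x k}\<close> tends to zero as \<open>m\<close> grows, so \<open>g k\<close> can be chosen to make the measure of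
  \<open>{x. g k < x k}\<close> less than \<open>2\<^sup>-\<^sup>k\<close>. By the first Borel--Cantelli lemma almost every sequence then
  exceeds \<open>g\<close> only finitely often (lemma \<open>ae_eventually_bounded\<close>). On the other
  hand, whatever \<open>g\<close> is, a Miller tree has a branch that exceeds it infinitely often: climb from
  one infinitely splitting node to the next, each time leaving the node through a successor larger
  than the value of \<open>g\<close> there (lemma \<open>miller_tree_body_unbounded\<close>). Such a branch is
  not in \<open>F\<close>.
\<close>

lemma length_prefix_chain:
  fixes s :: "nat \<Rightarrow> 'a list"
  assumes "\<And>n. strict_prefix (s n) (s (Suc n))"
  shows "n \<le> length (s n)"
proof (induction n)
  case (Suc n)
  then show ?case using prefix_length_less[OF assms, of n] by simp
qed simp

lemma prefix_chain_limit:
  fixes s :: "nat \<Rightarrow> 'a list"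
  assumes "\<And>n. strict_prefix (s n) (s (Suc n))"
  obtains x where "\<And>n. restrict_seq x (length (s n)) = s n"
proof -
  have mono: "prefix (s m) (s n)" if "m \<le> n" for m n
    using that assms
    by (induction rule: dec_induct) (auto intro: prefix_order.trans simp: prefix_order.less_imp_le)
  note long = length_prefix_chain[where s = s, OF assms]
  \<comment> \<open>Entry \<open>k\<close> is read off \<open>s (Suc k)\<close> because this list is certain to be longer than \<open>k\<close>.\<close>
  define x where "x k = s (Suc k) ! k" for k
  have x_nth: "x k = s n ! k" if "k < length (s n)" for k n
  proof -
    have k: "k < length (s (Suc k))" using long[of "Suc k"] by simp
    have "prefix (s (Suc k)) (s n) \<or> prefix (s n) (s (Suc k))" using mono linear by metis
    then show ?thesis unfolding x_def
      using k that by (auto simp: prefix_def nth_append)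
  qed
  have "restrict_seq x (length (s n)) = s n" for n
    unfolding restrict_seq_def by (rule nth_equalityI) (auto simp: x_nth)
  then show thesis by (rule that)
qed

lemma prefix_restrict_seq:
  "m \<le> n \<Longrightarrow> prefix (restrict_seq x m) (restrict_seq x n)"
  unfolding restrict_seq_def prefix_def
  by (metis le0 le_add_diff_inverse map_append upt_add_eq_append)

text \<open>
  Extending past \<open>\<sigma>\<close> to an infinitely splitting node makes room for one more entry above \<open>g\<close>; the
  bound that this entry has to beat depends on the length of that node, so the node is chosen first
  and its successor afterwards. The branch through the resulting nodes stays in the body because
  trees are closed under initial segments.
\<close>

lemma miller_tree_body_unbounded:
  fixes g :: "nat \<Rightarrow> nat"
  assumes "miller_tree T"
  obtains x where "x \<in> body T" and "\<exists>\<^sub>\<infinity>k. g k < x k"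
proof -
  have tree: "T \<noteq> {}" "\<And>\<sigma> \<tau>. \<tau> \<in> T \<Longrightarrow> prefix \<sigma> \<tau> \<Longrightarrow> \<sigma> \<in> T"
    using assms by (auto simp: miller_tree_def is_tree_def)
  have step: "\<exists>\<tau> a. prefix \<sigma> \<tau> \<and> \<tau> @ [a] \<in> T \<and> g (length \<tau>) < a" if "\<sigma> \<in> T" for \<sigma>
  proof -
    obtain \<tau> where \<tau>: "\<tau> \<in> omega_split T" "prefix \<sigma> \<tau>"
      using assms \<open>\<sigma> \<in> T\<close> by (auto simp: miller_tree_def)
    then have "infinite {a. \<tau> @ [a] \<in> T}" by (simp add: omega_split_def)
    then obtain a where "\<tau> @ [a] \<in> T" "g (length \<tau>) < a"
      unfolding infinite_nat_iff_unbounded by blast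
    with \<tau> show ?thesis by blast
  qed
  have "\<exists>s. \<forall>n. s n \<in> T \<and>
    (\<exists>\<tau> a. prefix (s n) \<tau> \<and> s (Suc n) = \<tau> @ [a] \<and> g (length \<tau>) < a)"
    by (rule dependent_nat_choice) (use tree step in blast)+
  then obtain s where s_in: "\<And>n. s n \<in> T"
    and s_step: "\<And>n. \<exists>\<tau> a. prefix (s n) \<tau> \<and> s (Suc n) = \<tau> @ [a] \<and> g (length \<tau>) < a"
    by blast
  have less: "strict_prefix (s n) (s (Suc n))" for n
    using s_step[of n] by (auto simp: strict_prefix_def prefix_def)
  obtain x where x: "\<And>n. restrict_seq x (length (s n)) = s n"
    using prefix_chain_limit less by blast
  note long = length_prefix_chain[where s = s, OF less]
  have "restrict_seq x n \<in> T" for n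
    using tree(2)[OF s_in] prefix_restrict_seq[OF long[of n], of x] by (simp add: x)
  then have "x \<in> body T" by (simp add: body_def)
  moreover have "\<exists>k\<ge>n. g k < x k" for n
  proof -
    obtain \<tau> a where \<tau>: "prefix (s n) \<tau>" "s (Suc n) = \<tau> @ [a]" "g (length \<tau>) < a"
      using s_step by blast
    have "x (length \<tau>) = a"
      using x[of "Suc n"] \<tau>(2) by (simp add: restrict_seq_def)
    moreover have "n \<le> length \<tau>" using long[of n] prefix_length_le[OF \<tau>(1)] by simp
    ultimately show ?thesis using \<tau>(3) by blast
  qed
  then have "\<exists>\<^sub>\<infinity>k. g k < x k" by (simp add: INFM_nat_le)
  ultimately show thesis by (rule that)
qed

text \<open>The coordinate maps are continuous and \<^typ>\<open>nat\<close> is discrete.\<close>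

lemma clopen_coordinate:
  fixes P :: "nat \<Rightarrow> bool" and k :: 'i
  shows "open {x :: 'i \<Rightarrow> nat. P (x k)}" and "closed {x :: 'i \<Rightarrow> nat. P (x k)}"
proof -
  have op: "open {x :: 'i \<Rightarrow> nat. Q (x k)}" for Q
    using open_vimage[OF Topological_Spaces.open_discrete[of "Collect Q"] continuous_on_product_coordinates[of k]]
    by (simp add: vimage_def)
  show "open {x :: 'i \<Rightarrow> nat. P (x k)}" by (rule op)
  show "closed {x :: 'i \<Rightarrow> nat. P (x k)}"
    unfolding closed_def Collect_neg_eq[symmetric] by (rule op)
qed

lemma fsigma_eventually_bounded:
  fixes g :: "nat \<Rightarrow> nat"
  shows "fsigma {x. \<forall>\<^sub>\<infinity>k. x k \<le> g k}"
proof -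
  have "closed (\<Inter>k\<in>{n..}. {x. x k \<le> g k})" for n
    by (rule closed_INT) (rule ballI, rule clopen_coordinate)
  then have "fsigma (\<Union>n. \<Inter>k\<in>{n..}. {x. x k \<le> g k})"
    by (rule fsigma.intros)
  also have "(\<Union>n. \<Inter>k\<in>{n..}. {x. x k \<le> g k}) = {x. \<forall>\<^sub>\<infinity>k. x k \<le> g k}"
    by (auto simp: MOST_nat_le)
  finally show ?thesis .
qed

text \<open>
  The events \<open>{x. g k < x k}\<close> are made summably small and Borel--Cantelli does the rest. Finiteness of
  the measure is what lets \<open>g k\<close> be found, through continuity along the decreasing sets
  \<open>{x. m < x k}\<close>, whose intersection is empty.
\<close>

lemma ae_eventually_bounded:
  fixes M :: "(nat \<Rightarrow> nat) measure"
  assumes "finite_measure M" and borel: "sets M = sets borel"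
  obtains g where "AE x in M. \<forall>\<^sub>\<infinity>k. x k \<le> g k"
proof -
  interpret finite_measure M by fact
  have sp: "space M = UNIV" using sets_eq_imp_space_eq[OF borel] by simp
  have meas: "{x. m < x k} \<in> sets M" for m k
    unfolding borel by (intro borel_open clopen_coordinate)
  have "\<exists>m. measure M {x. m < x k} < (1/2)^k" for k
  proof -
    have "(\<lambda>m. measure M {x. m < x k}) \<longlonglongrightarrow> measure M (\<Inter>m. {x. m < x k})"
      by (rule finite_Lim_measure_decseq) (use meas in \<open>auto simp: decseq_def\<close>)
    also have "(\<Inter>m. {x :: nat \<Rightarrow> nat. m < x k}) = {}" by auto
    finally have "(\<lambda>m. measure M {x. m < x k}) \<longlonglongrightarrow> 0" by simp
    then have "\<forall>\<^sub>F m in sequentially. measure M {x. m < x k} < (1/2)^k"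
      by (rule order_tendstoD) simp
    then show ?thesis by (auto simp: eventually_sequentially)
  qed
  then obtain g where g: "\<And>k. measure M {x. g k < x k} < (1/2)^k" by metis
  have "summable (\<lambda>k. measure M {x. g k < x k})"
    by (rule summable_comparison_test'[OF summable_geometric[of "1/2::real"], of 0])
       (auto intro: less_imp_le g)
  then have "AE x in M. eventually (\<lambda>k. x \<in> space M - {x. g k < x k}) sequentially"
    by (intro borel_cantelli_AE1) (use meas in \<open>auto simp: emeasure_eq_measure\<close>)
  then have "AE x in M. \<forall>\<^sub>\<infinity>k. x k \<le> g k"
    by (simp add: sp not_less cofinite_eq_sequentially)
  then show thesis by (rule that)
qed

theorem proposition10:
  fixes \<mu> :: "(nat \<Rightarrow> nat) measure"
  assumes "prob_space \<mu>"
    and "sets \<mu> = sets borel"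
    and "strictly_positive \<mu>"
  shows "\<exists>F :: (nat \<Rightarrow> nat) set.
    fsigma F \<and> emeasure \<mu> F = 1 \<and> (\<forall>T. miller_tree T \<longrightarrow> \<not> body T \<subseteq> F)"
proof -
  interpret prob_space \<mu> by fact
  obtain g where g: "AE x in \<mu>. \<forall>\<^sub>\<infinity>k. x k \<le> g k"
    using ae_eventually_bounded[OF finite_measure_axioms assms(2)] .
  define F where "F = {x. \<forall>\<^sub>\<infinity>k. x k \<le> g k}"
  have F: "fsigma F" unfolding F_def by (rule fsigma_eventually_bounded)
  then have "F \<in> sets \<mu>"
    unfolding assms(2) by (auto elim!: fsigma.cases)
  then have "emeasure \<mu> F = 1"
    using g by (intro emeasure_eq_1_AE) (auto simp: F_def)
  moreover have "\<not> body T \<subseteq> F" if T: "miller_tree T" for T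
  proof -
    obtain x where "x \<in> body T" "\<exists>\<^sub>\<infinity>k. g k < x k"
      using miller_tree_body_unbounded[OF T] .
    then show ?thesis
      by (auto simp: F_def MOST_nat_le INFM_nat_le subset_iff not_le)
  qed
  ultimately show ?thesis using F by blast
qed

end
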